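(* Let $(W,S)$ be a finite Coxeter system, $Q$ a word in $S$ and $\pi\in W$ such that the subword complex $\Delta(Q,\pi)$ is a simplicial sphere, equivalently $\delta(Q)=\pi$. Then $\Delta(Q,\pi)$ is isomorphic to $\Delta(Q',w_\circ)$ for some word $Q'$ in $S$ with $\delta(Q')=w_\circ$.
   Context: $w_\circ$ is the longest element of $W$. For a word $Q$ in $S$ and $\pi\in W$, the subword complex $\Delta(Q,\pi)$ is the simplicial complex on the positions of $Q$ whose faces are the sets $P$ of positions such that deleting them from $Q$ leaves a word containing a reduced expression for $\pi$ as a subword. The Demazure product $\delta$ of a word is defined recursively: $\delta$ of the empty word is the identity, and for $s\in S$, $\delta(Qs)=\delta(Q)s$ if $\ell(\delta(Q)s)>\ell(\delta(Q))$ and $\delta(Qs)=\delta(Q)$ otherwise. (It is known that $\Delta(Q,\pi)$ is a sphere iff $\delta(Q)=\pi$, and a ball otherwise.) *)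

theory Defs
  imports "HOL-Algebra.Group" "HOL-Homology.Homology" "HOL-Library.Sublist"
begin

section \<open>Coxeter systems\<close>

definition word_prod :: "('a, 'b) monoid_scheme \<Rightarrow> 'a list \<Rightarrow> 'a" where
  "word_prod W u = foldr (\<lambda>x y. x \<otimes>\<^bsub>W\<^esub> y) u \<one>\<^bsub>W\<^esub>"

text \<open>The entry 0 stands for infinity, that is, for the absence of a relation.\<close>

definition coxeter_matrix :: "'a set \<Rightarrow> ('a \<Rightarrow> 'a \<Rightarrow> nat) \<Rightarrow> bool" where
  "coxeter_matrix S m \<longleftrightarrow>
     (\<forall>s\<in>S. m s s = 1) \<and>
     (\<forall>s\<in>S. \<forall>t\<in>S. m s t = m t s \<and> (s \<noteq> t \<longrightarrow> m s t \<noteq> 1))"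

text \<open>The congruence on words generated by \<open>(s t)^(m s t) = 1\<close>.  Since \<open>m s s = 1\<close> makes
  every generator its own inverse, the quotient of the free monoid on \<open>S\<close> by this congruence is
  the group presented by these relations, so no formal inverses are needed.\<close>

inductive coxeter_cong :: "'a set \<Rightarrow> ('a \<Rightarrow> 'a \<Rightarrow> nat) \<Rightarrow> 'a list \<Rightarrow> 'a list \<Rightarrow> bool"
  for S m where
  rel: "s \<in> S \<Longrightarrow> t \<in> S \<Longrightarrow>
          coxeter_cong S m (u @ concat (replicate (m s t) [s, t]) @ v) (u @ v)"
| refl: "coxeter_cong S m u u"
| sym: "coxeter_cong S m u v \<Longrightarrow> coxeter_cong S m v u"
| trans: "coxeter_cong S m u v \<Longrightarrow> coxeter_cong S m v w \<Longrightarrow> coxeter_cong S m u w"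

locale coxeter_system = group W for W :: "('a, 'b) monoid_scheme" (structure) +
  fixes S :: "'a set"
  assumes gens_closed: "S \<subseteq> carrier W"
    and generated: "\<forall>w \<in> carrier W. \<exists>u \<in> lists S. word_prod W u = w"
    and presented: "\<exists>m. coxeter_matrix S m \<and>
          (\<forall>u \<in> lists S. \<forall>v \<in> lists S.
             word_prod W u = word_prod W v \<longleftrightarrow> coxeter_cong S m u v)"

locale finite_coxeter_system = coxeter_system +
  assumes finite_carrier: "finite (carrier W)"

definition cox_length :: "('a, 'b) monoid_scheme \<Rightarrow> 'a set \<Rightarrow> 'a \<Rightarrow> nat" where
  "cox_length W S w = (LEAST n. \<exists>u \<in> lists S. length u = n \<and> word_prod W u = w)"

definition reduced_expression ::
    "('a, 'b) monoid_scheme \<Rightarrow> 'a set \<Rightarrow> 'a list \<Rightarrow> 'a \<Rightarrow> bool" where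
  "reduced_expression W S u w \<longleftrightarrow>
     u \<in> lists S \<and> word_prod W u = w \<and> length u = cox_length W S w"

definition longest_element :: "('a, 'b) monoid_scheme \<Rightarrow> 'a set \<Rightarrow> 'a" where
  "longest_element W S = (ARG_MAX (cox_length W S) w. w \<in> carrier W)"

definition demazure :: "('a, 'b) monoid_scheme \<Rightarrow> 'a set \<Rightarrow> 'a list \<Rightarrow> 'a" where
  "demazure W S Q =
     foldl (\<lambda>w s. if cox_length W S (w \<otimes>\<^bsub>W\<^esub> s) > cox_length W S w then w \<otimes>\<^bsub>W\<^esub> s else w)
       \<one>\<^bsub>W\<^esub> Q"

lemma demazure_Nil: "demazure W S [] = \<one>\<^bsub>W\<^esub>"
  by (simp add: demazure_def)

lemma demazure_snoc:
  "demazure W S (Q @ [s]) =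
     (if cox_length W S (demazure W S Q \<otimes>\<^bsub>W\<^esub> s) > cox_length W S (demazure W S Q)
      then demazure W S Q \<otimes>\<^bsub>W\<^esub> s else demazure W S Q)"
  by (simp add: demazure_def)

section \<open>Simplicial complexes\<close>

text \<open>A complex is given by its set of faces; its vertices are the elements of its faces.
  In particular a subword complex may have fewer vertices than its word has positions, and
  isomorphisms are bijections between vertices, not between positions.\<close>

definition complex_iso :: "'v set set \<Rightarrow> 'w set set \<Rightarrow> bool" where
  "complex_iso K L \<longleftrightarrow>
     (\<exists>f. bij_betw f (\<Union>K) (\<Union>L) \<and> (\<forall>F. F \<subseteq> \<Union>K \<longrightarrow> (F \<in> K \<longleftrightarrow> f ` F \<in> L)))"

text \<open>Points are given by barycentric coordinates.  For finite complexes, the only ones considered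
  here, the subspace topology is the usual topology of the geometric realization.\<close>

definition geometric_realization :: "'v set set \<Rightarrow> ('v \<Rightarrow> real) topology" where
  "geometric_realization K = subtopology (powertop_real UNIV)
     {x. (\<forall>v. 0 \<le> x v) \<and> {v. x v \<noteq> 0} \<in> K \<and> (\<Sum>v | x v \<noteq> 0. x v) = 1}"

text \<open>The complex whose only face is the empty set is the sphere of dimension -1; the void complex,
  which has no faces at all, is not a sphere.\<close>

definition simplicial_sphere :: "'v set set \<Rightarrow> bool" where
  "simplicial_sphere K \<longleftrightarrow>
     K = {{}} \<or> (\<exists>d. geometric_realization K homeomorphic_space nsphere d)"

definition subword_complex ::
    "('a, 'b) monoid_scheme \<Rightarrow> 'a set \<Rightarrow> 'a list \<Rightarrow> 'a \<Rightarrow> nat set set" where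
  "subword_complex W S Q \<pi> =
     {P. P \<subseteq> {..<length Q} \<and>
         (\<exists>u. subseq u (nths Q (- P)) \<and> reduced_expression W S u \<pi>)}"

end

theory Submission
  imports Defs
begin

text \<open>
  If \<open>demazure W S Q = \<pi>\<close>, append to \<open>Q\<close> a reduced word \<open>c\<close> of \<open>\<pi>\<^sup>-\<^sup>1w\<^sub>0\<close>.  A reduced subword of \<open>Q\<close> is not longer
  than \<open>\<pi>\<close>, because in Bruhat order it represents an element below \<open>demazure W S Q\<close>; so a subword of
  \<open>Q @ c\<close> representing \<open>w\<^sub>0\<close> uses all of \<open>c\<close>, and the two subword complexes have the same faces.

  If \<open>demazure W S Q \<noteq> \<pi>\<close>, a nonvoid subword complex is collapsible, hence contractible and not a
  sphere.  Remove the last letter \<open>s\<close> of \<open>Q\<close>: if \<open>\<pi>s > \<pi>\<close>, the complex is a cone with apex \<open>s\<close>; if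
  \<open>\<pi>s < \<pi>\<close>, the deletion and the link of \<open>s\<close> are the complexes of the remaining word for \<open>\<pi>s\<close> and \<open>\<pi>\<close>,
  and neither of these is its Demazure product.

  All facts on Coxeter groups come from the strong exchange property.  For it, one counts how often a
  reflection occurs in the reflection sequence of a word: inserting a relator \<open>(s t)^(m s t)\<close> changes
  the count by an even number, so its parity depends only on the group element.
\<close>

section \<open>Collapsible complexes\<close>

definition simplicial_complex :: "'v set set \<Rightarrow> bool" where
  "simplicial_complex K \<longleftrightarrow> (\<forall>F\<in>K. finite F \<and> (\<forall>G\<subseteq>F. G \<in> K))"

text \<open>Read backwards, \<open>expand\<close> is an elementary collapse: \<open>F\<close> is a
  free face of the simplex \<open>insert a F\<close>, whose other proper faces already lie in
  \<open>K\<close>. That \<open>insert a F\<close> is new follows from \<open>F \<notin> K\<close>,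
  since \<open>K\<close> is closed under subsets.\<close>

inductive collapsible :: "'v set set \<Rightarrow> bool" where
  point: "collapsible {{}, {v}}"
| expand: "\<lbrakk>collapsible K; finite F; F \<noteq> {}; a \<notin> F; F \<notin> K;
     \<And>G. G \<subset> insert a F \<Longrightarrow> G \<noteq> F \<Longrightarrow> G \<in> K\<rbrakk>
     \<Longrightarrow> collapsible (insert F (insert (insert a F) K))"

lemma collapsible_imp_simplicial_complex:
  assumes "collapsible K"
  shows "simplicial_complex K"
  using assms
proof induction
  case (point v)
  show ?case by (auto simp: simplicial_complex_def)
next
  case (expand K F a)
  have *: "G \<in> insert F (insert (insert a F) K)" if "G \<subseteq> insert a F" for G
    using expand.hyps(6)[of G] that by blast
  show ?case
    unfolding simplicial_complex_def
  proof (intro ballI conjI allI impI)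
    fix H G assume "H \<in> insert F (insert (insert a F) K)" "G \<subseteq> H"
    then consider "G \<subseteq> insert a F" | "H \<in> K" by blast
    then show "G \<in> insert F (insert (insert a F) K)"
      using * expand.IH \<open>G \<subseteq> H\<close> by cases (auto simp: simplicial_complex_def)
  qed (use expand in \<open>auto simp: simplicial_complex_def\<close>)
qed

section \<open>Geometric realization of collapsible complexes\<close>

text \<open>The carrier of the realization as a plain set of functions, which makes
  \<open>continuous_on\<close> available for the maps below.\<close>

definition barycentric :: "'v set set \<Rightarrow> ('v \<Rightarrow> real) set" where
  "barycentric K = {x. (\<forall>v. 0 \<le> x v) \<and> {v. x v \<noteq> 0} \<in> K \<and> (\<Sum>v | x v \<noteq> 0. x v) = 1}"

lemma geometric_realization_eq: "geometric_realization K = top_of_set (barycentric K)"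
  by (simp add: geometric_realization_def barycentric_def euclidean_product_topology)

lemma continuous_on_Min_coordinates:
  fixes F :: "'v set"
  assumes "finite F" "F \<noteq> {}"
  shows "continuous_on A (\<lambda>x::'v \<Rightarrow> real. Min (x ` F))"
  using assms
proof (induction rule: finite_ne_induct)
  case (singleton v)
  show ?case by (auto intro: continuous_on_subset[OF continuous_on_product_coordinates])
next
  case (insert v F)
  have "continuous_on A (\<lambda>x::'v \<Rightarrow> real. min (x v) (Min (x ` F)))"
    by (intro continuous_on_min insert.IH continuous_on_subset[OF continuous_on_product_coordinates]) auto
  with insert.hyps show ?case by (simp cong: continuous_on_cong_simp)
qed

text \<open>For \<open>c = 1\<close>, a point in the interior of \<open>F\<close> or \<open>insert a F\<close> is moved parallel to the segment
  from the barycenter of \<open>F\<close> to \<open>a\<close> until some coordinate in \<open>F\<close> vanishes.  All other points of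
  the complex have \<open>Min (x ` F) = 0\<close> and stay fixed.\<close>

definition push :: "'v set \<Rightarrow> 'v \<Rightarrow> real \<Rightarrow> ('v \<Rightarrow> real) \<Rightarrow> 'v \<Rightarrow> real" where
  "push F a c x = (\<lambda>v. x v + c * Min (x ` F) *
     (if v = a then real (card F) else if v \<in> F then -1 else 0))"

lemma continuous_on_push:
  assumes "finite F" "F \<noteq> {}"
  shows "continuous_on A (\<lambda>z. push F a (fst z) (snd z))"
proof (rule continuous_on_coordinatewise_then_product)
  fix v
  have 1: "continuous_on A (\<lambda>z. snd z v)"
    by (rule continuous_on_compose2[OF continuous_on_product_coordinates[of v]])
       (auto intro: continuous_intros)
  have 2: "continuous_on A (\<lambda>z. Min (snd z ` F))"
    by (rule continuous_on_compose2[OF continuous_on_Min_coordinates[OF assms, of UNIV]])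
       (auto intro: continuous_intros)
  show "continuous_on A (\<lambda>z. push F a (fst z) (snd z) v)"
    unfolding push_def by (intro continuous_intros 1 2)
qed

text \<open>These are the ingredients of a deformation retraction onto \<open>K\<close>. The
  coordinate sum is preserved because \<open>a\<close> gains \<open>card F\<close> times the amount
  that each vertex of \<open>F\<close> loses.\<close>

lemma push_in_barycentric:
  assumes K: "simplicial_complex K" and F: "finite F" "F \<noteq> {}" "a \<notin> F" "F \<notin> K"
    and faces: "\<And>G. G \<subset> insert a F \<Longrightarrow> G \<noteq> F \<Longrightarrow> G \<in> K"
    and x: "x \<in> barycentric (insert F (insert (insert a F) K))"
    and c: "0 \<le> c" "c \<le> 1"
  shows "push F a c x \<in> barycentric (insert F (insert (insert a F) K))"
    and "push F a 1 x \<in> barycentric K"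
    and "x \<in> barycentric K \<Longrightarrow> push F a c x = x"
proof -
  let ?K' = "insert F (insert (insert a F) K)"
  define m where "m = Min (x ` F)"
  define supp where "supp = {v. x v \<noteq> 0}"
  have nn: "0 \<le> x v" for v using x by (auto simp: barycentric_def)
  have suppK: "supp \<in> ?K'" and sum1: "(\<Sum>v\<in>supp. x v) = 1"
    using x by (auto simp: barycentric_def supp_def)
  have m_le: "m \<le> x v" if "v \<in> F" for v
    using F that by (simp add: m_def)
  have m_in: "m \<in> x ` F" unfolding m_def using F by (intro Min_in) auto
  then have m0: "0 \<le> m" using nn by auto
  have F_supp: "F \<subseteq> supp" if "m > 0"
    using m_le that unfolding supp_def by fastforce
  have notin: "H \<notin> K" if "F \<subseteq> H" for H
    using K F(4) that unfolding simplicial_complex_def by blast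
  \<comment> \<open>A positive minimum over \<open>F\<close> occurs only in the interiors of the two
    new faces.\<close>
  have ext: "supp = F \<or> supp = insert a F" if "m > 0"
    using suppK notin F_supp that by blast
  have push_id: "push F a c' x = x" if "m = 0" for c'
    using that by (simp add: push_def m_def)
  have pos: "push F a c' x \<in> barycentric ?K' \<and> (c' = 1 \<longrightarrow> push F a c' x \<in> barycentric K)"
    if m: "m > 0" and c': "0 \<le> c'" "c' \<le> 1" for c'
  proof -
    define y where "y = push F a c' x"
    have ya: "y a = x a + c' * m * real (card F)" by (simp add: y_def push_def m_def)
    have yF: "y v = x v - c' * m" if "v \<in> F" for v
      using that F by (auto simp: y_def push_def m_def)
    have yo: "y v = x v" if "v \<notin> insert a F" for v
      using that by (simp add: y_def push_def)
    have xo: "x v = 0" if "v \<notin> insert a F" for v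
      using ext[OF m] that by (auto simp: supp_def)
    have cm: "c' * m \<le> x v" if "v \<in> F" for v
      using m_le[OF that] mult_right_mono[OF c'(2) m0] by simp
    have ynn: "0 \<le> y v" for v
      using nn[of v] cm[of v] ya yF[of v] yo[of v] c' m0 by (cases "v = a"; cases "v \<in> F") auto
    have ysub: "{v. y v \<noteq> 0} \<subseteq> insert a F" using yo xo by force
    have "(\<Sum>v | y v \<noteq> 0. y v) = (\<Sum>v\<in>insert a F. y v)"
      by (rule sum.mono_neutral_left) (use F ysub in auto)
    also have "\<dots> = y a + (\<Sum>v\<in>F. x v - c' * m)" using F yF by simp
    also have "\<dots> = (\<Sum>v\<in>insert a F. x v)"
      using F by (simp add: ya sum_subtractf)
    also have "\<dots> = (\<Sum>v\<in>supp. x v)"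
      by (rule sum.mono_neutral_right) (use F xo in \<open>auto simp: supp_def\<close>)
    finally have ysum: "(\<Sum>v | y v \<noteq> 0. y v) = 1" using sum1 by simp
    have "{v. y v \<noteq> 0} \<in> ?K'" using ysub faces by blast
    then have 1: "y \<in> barycentric ?K'" using ynn ysum by (simp add: barycentric_def)
    \<comment> \<open>At full time a vertex of \<open>F\<close> attaining the minimum leaves the
      support, while \<open>a\<close> belongs to it. So the support is a proper face of
      \<open>insert a F\<close> other than \<open>F\<close>.\<close>
    have 2: "y \<in> barycentric K" if "c' = 1"
    proof -
      have "y a \<noteq> 0" using ya nn[of a] m F that by (simp add: add_nonneg_eq_0_iff)
      moreover obtain v where v: "v \<in> F" "m = x v" using m_in by auto
      moreover have "y v = 0" using yF[OF v(1)] v(2) that by simp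
      ultimately have "v \<in> insert a F - {v. y v \<noteq> 0}" "a \<in> {v. y v \<noteq> 0} - F"
        using F by auto
      then have "{v. y v \<noteq> 0} \<subset> insert a F" "{v. y v \<noteq> 0} \<noteq> F"
        using ysub by blast+
      then have "{v. y v \<noteq> 0} \<in> K" by (rule faces)
      then show ?thesis using ynn ysum by (simp add: barycentric_def)
    qed
    show ?thesis using 1 2 by (simp add: y_def)
  qed
  \<comment> \<open>If the minimum is 0, the support misses a vertex of \<open>F\<close>, so it is
    neither of the two new faces.\<close>
  have in_K: "x \<in> barycentric K" if "m = 0"
  proof -
    obtain v where v: "v \<in> F" "m = x v" using m_in by auto
    then have "supp \<noteq> F" "supp \<noteq> insert a F" using that by (auto simp: supp_def)
    then show ?thesis using suppK x by (auto simp: barycentric_def supp_def)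
  qed
  show "push F a c x \<in> barycentric ?K'"
    using pos[OF _ c] push_id x m0 by (cases "m = 0") auto
  show "push F a 1 x \<in> barycentric K"
    using pos[of 1] push_id in_K m0 by (cases "m = 0") auto
  show "push F a c x = x" if "x \<in> barycentric K"
  proof -
    have "supp \<in> K" using that by (simp add: barycentric_def supp_def)
    then have "m = 0" using notin F_supp m0 by force
    then show ?thesis by (rule push_id)
  qed
qed

text \<open>The base complex is realized by at most one point. Each expansion is undone by the
  deformation retraction \<open>push F a c\<close> with time \<open>c\<close> from 0 to 1, so
  contractibility passes from \<open>K\<close> to the larger complex.\<close>

lemma collapsible_imp_contractible:
  assumes "collapsible K"
  shows "contractible_space (geometric_realization K)"
  using assms
proof induction
  case (point v)
  have "x = (\<lambda>w. if w = v then 1 else 0)" if "x \<in> barycentric {{}, {v}}" for x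
  proof -
    from that have *: "{w. x w \<noteq> 0} = {} \<or> {w. x w \<noteq> 0} = {v}" and s: "(\<Sum>w | x w \<noteq> 0. x w) = 1"
      by (auto simp: barycentric_def)
    then have **: "{w. x w \<noteq> 0} = {v}" by auto
    with s have "x v = 1" by simp
    with ** show ?thesis by (intro ext) auto
  qed
  then have "barycentric {{}, {v}} \<subseteq> {\<lambda>w. if w = v then 1 else 0}" by blast
  then show ?case
    unfolding geometric_realization_eq by (intro contractible_space_subset_singleton) auto
next
  case (expand K F a)
  let ?K' = "insert F (insert (insert a F) K)"
  let ?A = "barycentric ?K'" and ?B = "barycentric K"
  have K: "simplicial_complex K" by (rule collapsible_imp_simplicial_complex) fact
  note push = push_in_barycentric[OF K expand.hyps(2-5) expand.hyps(6)]
  have BA: "?B \<subseteq> ?A" by (auto simp: barycentric_def)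
  have cont: "continuous_on C (push F a 1)" for C
    using continuous_on_compose2[OF continuous_on_push[OF expand.hyps(2,3), of UNIV a],
        of C "\<lambda>x. (1, x)"]
      continuous_on_Pair[OF continuous_on_const[of C 1] continuous_on_id] by simp
  have "homotopic_with_canon (\<lambda>x. True) ?A ?A id (push F a 1)"
    unfolding homotopic_with_def
  proof (intro exI conjI)
    show "continuous_map (prod_topology (top_of_set {0..1}) (top_of_set ?A)) (top_of_set ?A)
        (\<lambda>z. push F a (fst z) (snd z))"
      using continuous_on_push[OF expand.hyps(2,3)] push(1) by auto
  qed (auto simp: push_def)
  moreover have "retraction_maps (top_of_set ?A) (top_of_set ?B) (push F a 1) id"
    unfolding retraction_maps_def using cont push(2)[of _ 1] push(3)[of _ 1] BA by auto
  ultimately have "top_of_set ?A homotopy_equivalent_space top_of_set ?B"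
    by (intro deformation_retract_imp_homotopy_equivalent_space[of _ "push F a 1"])
       (auto intro: homotopic_with_symD)
  then show ?case
    using expand.IH homotopy_equivalent_space_contractibility
    unfolding geometric_realization_eq by blast
qed

text \<open>No \<open>nsphere d\<close> is contractible. The sphere of dimension -1 is a separate
  case of the definition, excluded because a collapsible complex has a vertex.\<close>

lemma collapsible_not_sphere:
  assumes "collapsible K"
  shows "\<not> simplicial_sphere K"
proof -
  have "K \<noteq> {{}}" using assms by (induction rule: collapsible.induct) auto
  then show ?thesis
    unfolding simplicial_sphere_def
    using collapsible_imp_contractible[OF assms] homeomorphic_space_contractibility
      non_contractible_space_nsphere by blast
qed

section \<open>Cones and collapsibility\<close>

text \<open>This recombines a deletion \<open>A\<close> and a link \<open>L\<close> of the vertex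
  \<open>v\<close>. Building up \<open>L\<close> by expansions, each pair \<open>F\<close>,
  \<open>insert a F\<close> yields an expansion by the same two faces with \<open>v\<close> added;
  the starting vertex \<open>w\<close> of \<open>L\<close> yields \<open>{v}\<close> and the edge
  joining it to \<open>w\<close>.\<close>

lemma collapsible_attach_cone:
  assumes "collapsible L" "collapsible A" "L \<subseteq> A" "v \<notin> \<Union>A"
  shows "collapsible (A \<union> insert v ` L)"
  using assms
proof (induction)
  case (point w)
  have "collapsible (insert {v} (insert (insert w {v}) A))"
  proof (rule collapsible.expand)
    fix G assume "G \<subset> insert w {v}" "G \<noteq> {v}"
    then have "G = {} \<or> G = {w}" by auto
    then show "G \<in> A" using point by auto
  qed (use point in auto)
  moreover have "A \<union> insert v ` {{}, {w}} = insert {v} (insert (insert w {v}) A)"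
    by auto
  ultimately show ?case by simp
next
  case (expand K F a)
  have FA: "F \<in> A" "insert a F \<in> A" and KA: "K \<subseteq> A" using expand.prems by auto
  have vF: "v \<notin> F" "v \<noteq> a" using FA expand.prems by auto
  have "collapsible (insert (insert v F) (insert (insert a (insert v F)) (A \<union> insert v ` K)))"
  proof (rule collapsible.expand)
    show "collapsible (A \<union> insert v ` K)" using expand by auto
    show "insert v F \<notin> A \<union> insert v ` K"
    proof
      assume "insert v F \<in> A \<union> insert v ` K"
      then obtain H where H: "H \<in> K" "insert v F = insert v H" using expand.prems by auto
      then have "v \<notin> H" using KA expand.prems by auto
      with H vF have "F = H" by auto
      with H expand.hyps show False by simp
    qed
    fix G assume G: "G \<subset> insert a (insert v F)" "G \<noteq> insert v F"
    show "G \<in> A \<union> insert v ` K"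
    \<comment> \<open>Faces without \<open>v\<close> lie in \<open>insert a F\<close>, a face of
      \<open>A\<close>; from the others \<open>v\<close> is removed to reach a face of
      \<open>K\<close>.\<close>
    proof (cases "v \<in> G")
      case False
      then have "G \<subseteq> insert a F" using G by auto
      moreover have "simplicial_complex A" by (rule collapsible_imp_simplicial_complex) fact
      ultimately show ?thesis using FA by (auto simp: simplicial_complex_def)
    next
      case True
      have "G - {v} \<subset> insert a F" "G - {v} \<noteq> F" using G True vF by auto
      then have "G - {v} \<in> K" by (rule expand.hyps(6))
      then show ?thesis using True by (metis UnCI imageI insert_Diff)
    qed
  qed (use expand vF in auto)
  moreover have "A \<union> insert v ` insert F (insert (insert a F) K) =
      insert (insert v F) (insert (insert a (insert v F)) (A \<union> insert v ` K))"
    by auto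
  ultimately show ?case by simp
qed

text \<open>Any nonvoid finite base will do: the pairs \<open>F\<close>, \<open>insert v F\<close>
  with \<open>F\<close> nonempty are collapsed away, a maximal \<open>F\<close> first, until only
  the apex \<open>v\<close> is left.\<close>

lemma collapsible_cone:
  assumes "finite L" "simplicial_complex L" "{} \<in> L" "v \<notin> \<Union>L"
  shows "collapsible (L \<union> insert v ` L)"
  using assms
proof (induction "card L" arbitrary: L rule: less_induct)
  case less
  show ?case
  proof (cases "L = {{}}")
    case True
    then show ?thesis using collapsible.point[of v] by (simp add: insert_commute)
  next
    case False
    have "L \<noteq> {}" using less.prems(3) by auto
    from finite_has_maximal[OF less.prems(1) this]
    obtain F where F: "F \<in> L" "\<And>G. G \<in> L \<Longrightarrow> F \<subseteq> G \<Longrightarrow> G = F" by auto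
    have F0: "F \<noteq> {}" using F False less.prems(3) by auto
    let ?L = "L - {F}"
    have vF: "v \<notin> F" using F less.prems by auto
    have sub: "G \<in> ?L" if "G \<subset> F" for G
      using that F less.prems(2) by (auto simp: simplicial_complex_def)
    have "collapsible (insert F (insert (insert v F) (?L \<union> insert v ` ?L)))"
    proof (rule collapsible.expand)
      \<comment> \<open>Maximality of \<open>F\<close> keeps the remaining set of faces closed under
        subsets.\<close>
      have cx: "simplicial_complex ?L"
        unfolding simplicial_complex_def
      proof (intro ballI conjI allI impI)
        fix H G assume H: "H \<in> ?L" "G \<subseteq> H"
        then have "G \<in> L" using less.prems(2) by (auto simp: simplicial_complex_def)
        moreover have "G \<noteq> F" using H F(2)[of H] by auto
        ultimately show "G \<in> ?L" by simp
      qed (use less.prems(2) in \<open>auto simp: simplicial_complex_def\<close>)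
      have "card ?L < card L" using less.prems(1) F(1) by (rule card_Diff1_less)
      then show "collapsible (?L \<union> insert v ` ?L)"
        using cx less.prems F0 by (intro less.hyps) auto
      show "finite F" using F less.prems by (auto simp: simplicial_complex_def)
      show "F \<notin> ?L \<union> insert v ` ?L" using vF by auto
      fix G assume G: "G \<subset> insert v F" "G \<noteq> F"
      show "G \<in> ?L \<union> insert v ` ?L"
      proof (cases "v \<in> G")
        case False
        then have "G \<subset> F" using G by auto
        then show ?thesis using sub by simp
      next
        case True
        then have "G - {v} \<subset> F" using G by auto
        then have "G - {v} \<in> ?L" by (rule sub)
        then show ?thesis using True by (metis UnCI imageI insert_Diff)
      qed
    qed (use F0 vF in auto)
    moreover have "L \<union> insert v ` L = insert F (insert (insert v F) (?L \<union> insert v ` ?L))"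
      using F by auto
    ultimately show ?thesis by simp
  qed
qed

section \<open>Sublists selected by sets of positions\<close>

lemma nths_cong: "(\<And>i. i < length xs \<Longrightarrow> i \<in> A \<longleftrightarrow> i \<in> B) \<Longrightarrow> nths xs A = nths xs B"
  unfolding nths_def by (intro arg_cong[where f = "map fst"] filter_cong) (auto simp: set_zip)

lemma subseq_nths: "subseq (nths xs A) xs"
  using subseq_conv_nths by blast

lemma subseq_nths_mono: "A \<subseteq> B \<Longrightarrow> subseq (nths xs A) (nths xs B)"
proof (induction xs arbitrary: A B)
  case (Cons x xs)
  have "subseq (nths xs {j. Suc j \<in> A}) (nths xs {j. Suc j \<in> B})"
    using Cons.prems by (intro Cons.IH) auto
  then show ?case using Cons.prems by (auto simp: nths_Cons)
qed simp

section \<open>Reflections and strong exchange\<close>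

context coxeter_system
begin

abbreviation wp :: "'a list \<Rightarrow> 'a" where "wp \<equiv> word_prod W"
abbreviation len :: "'a \<Rightarrow> nat" where "len \<equiv> cox_length W S"
abbreviation red :: "'a list \<Rightarrow> 'a \<Rightarrow> bool" where "red \<equiv> reduced_expression W S"

declare in_lists_conv_set [simp]

lemma word_prod_Nil [simp]: "wp [] = \<one>"
  and word_prod_Cons [simp]: "wp (s # u) = s \<otimes> wp u"
  by (simp_all add: word_prod_def)

lemma gen_closed [simp]: "s \<in> S \<Longrightarrow> s \<in> carrier W"
  using gens_closed by blast

lemma word_prod_closed [simp]: "u \<in> lists S \<Longrightarrow> wp u \<in> carrier W"
  by (induction u) auto

lemma word_prod_append [simp]:
  "u \<in> lists S \<Longrightarrow> v \<in> lists S \<Longrightarrow> wp (u @ v) = wp u \<otimes> wp v"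
  by (induction u) (auto simp: m_assoc)

lemma gen_square [simp]: assumes "s \<in> S" shows "s \<otimes> s = \<one>"
proof -
  obtain m where m: "coxeter_matrix S m"
    and p: "\<forall>u \<in> lists S. \<forall>v \<in> lists S. wp u = wp v \<longleftrightarrow> coxeter_cong S m u v"
    using presented by blast
  have "coxeter_cong S m ([] @ concat (replicate (m s s) [s, s]) @ []) ([] @ [])"
    using assms by (intro coxeter_cong.rel)
  moreover have "m s s = 1" using m assms by (simp add: coxeter_matrix_def)
  ultimately have "coxeter_cong S m [s, s] []" by simp
  then have "wp [s, s] = wp []" using p[rule_format, of "[s, s]" "[]"] assms by simp
  then show ?thesis using assms by simp
qed

lemma gen_inv [simp]: "s \<in> S \<Longrightarrow> inv s = s"
  by (rule inv_equality) auto

lemma gen_cancel [simp]: "s \<in> S \<Longrightarrow> x \<in> carrier W \<Longrightarrow> s \<otimes> (s \<otimes> x) = x"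
  by (simp flip: m_assoc)

lemma gen_cancel_right [simp]: "s \<in> S \<Longrightarrow> x \<in> carrier W \<Longrightarrow> x \<otimes> s \<otimes> s = x"
  by (simp add: m_assoc)

lemma inv_cancel_left [simp]:
  assumes "g \<in> carrier W" "x \<in> carrier W"
  shows "inv g \<otimes> (g \<otimes> x) = x" "g \<otimes> (inv g \<otimes> x) = x"
  using assms by (simp_all flip: m_assoc)

lemma inv_word_prod: "u \<in> lists S \<Longrightarrow> inv (wp u) = wp (rev u)"
  by (induction u) (auto simp: inv_mult_group)

text \<open>The reflections \<open>x\<close> such that right multiplication by \<open>x\<close> deletes one letter of the word.\<close>

primrec refls :: "'a list \<Rightarrow> 'a list" where
  "refls [] = []"
| "refls (s # u) = inv (wp u) \<otimes> s \<otimes> wp u # refls u"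

lemma refls_closed: "u \<in> lists S \<Longrightarrow> set (refls u) \<subseteq> carrier W"
  by (induction u) auto

lemma refls_append:
  "u \<in> lists S \<Longrightarrow> v \<in> lists S \<Longrightarrow>
     refls (u @ v) = map (\<lambda>r. inv (wp v) \<otimes> r \<otimes> wp v) (refls u) @ refls v"
  by (induction u) (auto simp: m_assoc inv_mult_group)

text \<open>Turns the conjugation in \<open>refls_append\<close> into a change of the element that
  is counted.\<close>

lemma count_list_conjugate:
  assumes "set rs \<subseteq> carrier W" "y \<in> carrier W" "x \<in> carrier W"
  shows "count_list (map (\<lambda>r. inv y \<otimes> r \<otimes> y) rs) x = count_list rs (y \<otimes> x \<otimes> inv y)"
proof -
  have "inv y \<otimes> r \<otimes> y = x \<longleftrightarrow> r = y \<otimes> x \<otimes> inv y" if "r \<in> carrier W" for r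
    using that assms by (metis inv_closed inv_solve_left inv_solve_right m_assoc m_closed)
  then show ?thesis using assms(1) by (induction rs) auto
qed

text \<open>In the dihedral group generated by \<open>s\<close> and \<open>t\<close>, conjugation by
  \<open>t\<close> inverts \<open>s \<otimes> t\<close>.\<close>

lemma dihedral_flip:
  assumes "s \<in> S" "t \<in> S"
  shows "inv ((s \<otimes> t) [^] (k::nat)) \<otimes> t = t \<otimes> (s \<otimes> t) [^] k"
proof (induction k)
  case (Suc k)
  let ?b = "s \<otimes> t"
  have b: "?b \<in> carrier W" using assms by simp
  have "inv (?b [^] Suc k) \<otimes> t = inv ?b \<otimes> (inv (?b [^] k) \<otimes> t)"
    using assms b by (simp add: inv_mult_group m_assoc)
  also have "\<dots> = t \<otimes> s \<otimes> (t \<otimes> ?b [^] k)"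
    unfolding Suc using assms by (simp add: inv_mult_group)
  also have "\<dots> = t \<otimes> (?b \<otimes> ?b [^] k)"
    using assms by (simp add: m_assoc)
  also have "?b \<otimes> ?b [^] k = ?b [^] Suc k" by (rule nat_pow_Suc2[OF b, symmetric])
  finally show ?case by simp
qed (use assms in simp)

lemma word_prod_alternating:
  assumes "s \<in> S" "t \<in> S"
  shows "wp (concat (replicate k [s, t])) = (s \<otimes> t) [^] k"
proof (induction k)
  case (Suc k)
  then have "wp (concat (replicate (Suc k) [s, t])) = s \<otimes> t \<otimes> (s \<otimes> t) [^] k"
    using assms by (simp add: m_assoc)
  also have "\<dots> = (s \<otimes> t) [^] Suc k"
    using assms by (intro nat_pow_Suc2[symmetric]) simp
  finally show ?case .
qed simp

text \<open>Prepending one more pair to \<open>k\<close> pairs adds the exponent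
  \<open>2 * k\<close> for its letter \<open>t\<close> and \<open>Suc (2 * k)\<close> for its letter
  \<open>s\<close>. New entries come first, hence the \<open>rev\<close>.\<close>

lemma refls_alternating:
  assumes "s \<in> S" "t \<in> S"
  shows "refls (concat (replicate k [s, t])) = rev (map (\<lambda>i. t \<otimes> (s \<otimes> t) [^] i) [0..<2*k])"
proof (induction k)
  case (Suc k)
  define b where "b = s \<otimes> t"
  have b: "b \<in> carrier W" and t: "t \<in> carrier W" using assms by (simp_all add: b_def)
  have flip: "inv (b [^] k) \<otimes> t = t \<otimes> b [^] k"
    unfolding b_def by (rule dihedral_flip) fact+
  have pow2: "b [^] k \<otimes> b [^] k = b [^] (2 * k)"
    using b by (simp add: nat_pow_mult mult_2)
  have 1: "inv (b [^] k) \<otimes> t \<otimes> b [^] k = t \<otimes> b [^] (2 * k)"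
    unfolding flip using b t by (simp add: m_assoc pow2)
  have "inv (t \<otimes> b [^] k) \<otimes> s \<otimes> (t \<otimes> b [^] k) = inv (b [^] k) \<otimes> t \<otimes> (b \<otimes> b [^] k)"
    using assms b unfolding b_def by (simp add: inv_mult_group m_assoc)
  also have "b \<otimes> b [^] k = b [^] k \<otimes> b" using nat_pow_Suc2[OF b, of k] by simp
  also have "inv (b [^] k) \<otimes> t \<otimes> (b [^] k \<otimes> b) = t \<otimes> (b [^] k \<otimes> b [^] k \<otimes> b)"
    unfolding flip using b t by (simp add: m_assoc)
  finally have 2: "inv (t \<otimes> b [^] k) \<otimes> s \<otimes> (t \<otimes> b [^] k) = t \<otimes> b [^] Suc (2 * k)"
    by (simp add: pow2)
  show ?case
    using 1 2 Suc by (simp add: word_prod_alternating[OF assms] flip: b_def)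
qed simp

text \<open>The listed reflections have period \<open>k\<close> in the exponent and there are
  \<open>2 * k\<close> of them, so one list is run through twice.\<close>

lemma even_count_refls_relator:
  assumes "s \<in> S" "t \<in> S" "(s \<otimes> t) [^] k = \<one>"
  shows "even (count_list (refls (concat (replicate k [s, t]))) x)"
proof -
  let ?f = "\<lambda>i::nat. t \<otimes> (s \<otimes> t) [^] i"
  have "?f (i + k) = ?f i" for i
    using assms by (simp flip: nat_pow_mult)
  then have "map ?f [k..<k + k] = map ?f [0..<k]"
    by (intro nth_equalityI) (auto simp: add.commute)
  moreover have "[0..<2 * k] = [0..<k] @ [k..<k + k]"
    using upt_add_eq_append[of 0 k k] by (simp add: mult_2)
  ultimately have "map ?f [0..<2 * k] = map ?f [0..<k] @ map ?f [0..<k]" by simp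
  then show ?thesis
    by (simp add: refls_alternating[OF assms(1,2)])
qed

text \<open>A relator has product \<open>\<one>\<close>, so inserting it leaves the entries from
  \<open>u\<close> and \<open>v\<close> alone and adds conjugates of its own entries, an even number
  of each. Membership in \<open>lists S\<close> is carried along for the intermediate word of
  \<open>trans\<close>.\<close>

lemma coxeter_cong_refls_parity:
  assumes "coxeter_cong S m u v" "x \<in> carrier W"
    and "\<And>s t. s \<in> S \<Longrightarrow> t \<in> S \<Longrightarrow> (s \<otimes> t) [^] m s t = \<one>"
  shows "(u \<in> lists S \<longleftrightarrow> v \<in> lists S) \<and>
    (u \<in> lists S \<longrightarrow> even (count_list (refls u) x) = even (count_list (refls v) x))"
  using assms(1)
proof induction
  case (rel s t u v)
  let ?r = "concat (replicate (m s t) [s, t])"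
  have r: "?r \<in> lists S" using rel by (auto simp: in_lists_conv_set)
  have r1: "wp ?r = \<one>" using rel assms(3) by (simp add: word_prod_alternating)
  have "even (count_list (refls (u @ ?r @ v)) x) = even (count_list (refls (u @ v)) x)"
    if uv: "u \<in> lists S" "v \<in> lists S"
  proof -
    have "even (count_list (map (\<lambda>y. inv (wp v) \<otimes> y \<otimes> wp v) (refls ?r)) x)"
      unfolding count_list_conjugate[OF refls_closed[OF r] word_prod_closed[OF uv(2)] assms(2)]
      using rel assms(3) by (intro even_count_refls_relator) auto
    moreover have "?r @ v \<in> lists S" "wp (?r @ v) = wp v" using uv r r1 by auto
    ultimately show ?thesis
      using uv r by (simp add: refls_append del: append_in_lists_conv)
  qed
  with r show ?case by auto
qed auto

text \<open>By the presentation, equal products mean congruent words, so the parity is an invariant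
  of the group element.\<close>

lemma refls_parity:
  assumes "u \<in> lists S" "v \<in> lists S" "wp u = wp v" "x \<in> carrier W"
  shows "even (count_list (refls u) x) = even (count_list (refls v) x)"
proof -
  obtain m where p: "\<forall>u \<in> lists S. \<forall>v \<in> lists S. wp u = wp v \<longleftrightarrow> coxeter_cong S m u v"
    using presented by blast
  have rel: "(s \<otimes> t) [^] m s t = \<one>" if "s \<in> S" "t \<in> S" for s t
  proof -
    have "coxeter_cong S m ([] @ concat (replicate (m s t) [s, t]) @ []) ([] @ [])"
      using that by (intro coxeter_cong.rel)
    moreover have "concat (replicate (m s t) [s, t]) \<in> lists S"
      using that by (auto simp: in_lists_conv_set)
    ultimately have "wp (concat (replicate (m s t) [s, t])) = wp []"
      using p[rule_format, of "concat (replicate (m s t) [s, t])" "[]"] by simp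
    then show ?thesis using that by (simp add: word_prod_alternating)
  qed
  have "coxeter_cong S m u v" using p assms by blast
  from coxeter_cong_refls_parity[OF this assms(4) rel] assms(1) show ?thesis by blast
qed

definition reflections :: "'a set" where
  "reflections = {g \<otimes> s \<otimes> inv g | g s. g \<in> carrier W \<and> s \<in> S}"

lemma reflectionsE:
  assumes "x \<in> reflections"
  obtains g s where "x = g \<otimes> s \<otimes> inv g" "g \<in> carrier W" "s \<in> S"
  using assms unfolding reflections_def by blast

lemma reflections_closed [simp]: "x \<in> reflections \<Longrightarrow> x \<in> carrier W"
  by (auto simp: reflections_def)

lemma gen_reflection: "s \<in> S \<Longrightarrow> s \<in> reflections"
  unfolding reflections_def by (intro CollectI exI[of _ \<one>] exI[of _ s]) simp

lemma reflection_square: "x \<in> reflections \<Longrightarrow> x \<otimes> x = \<one>"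
proof -
  assume "x \<in> reflections"
  then obtain g s where x: "x = g \<otimes> s \<otimes> inv g" "g \<in> carrier W" "s \<in> S"
    by (rule reflectionsE)
  then show ?thesis by (simp add: m_assoc)
qed

lemma reflection_conj_gen:
  assumes "x \<in> reflections" "s \<in> S"
  shows "s \<otimes> x \<otimes> s \<in> reflections"
proof -
  obtain g r where x: "x = g \<otimes> r \<otimes> inv g" "g \<in> carrier W" "r \<in> S"
    using assms(1) by (rule reflectionsE)
  have "s \<otimes> x \<otimes> s = (s \<otimes> g) \<otimes> r \<otimes> inv (s \<otimes> g)"
    using x assms(2) by (simp add: inv_mult_group m_assoc)
  moreover have "s \<otimes> g \<in> carrier W" using x assms by simp
  ultimately show ?thesis using x(3) unfolding reflections_def by blast
qed

text \<open>The witness is the palindrome \<open>p @ s # rev p\<close> with \<open>p\<close> a word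
  for \<open>g\<close>. Its middle letter contributes \<open>x\<close> once; the two halves together
  contribute an even number.\<close>

lemma reflection_odd:
  assumes "x \<in> reflections"
  obtains u where "u \<in> lists S" "wp u = x" "odd (count_list (refls u) x)"
proof -
  obtain g s where x: "x = g \<otimes> s \<otimes> inv g" and g: "g \<in> carrier W" and s: "s \<in> S"
    using assms(1) by (rule reflectionsE)
  have xc: "x \<in> carrier W" using assms by simp
  obtain p where p: "p \<in> lists S" "wp p = g" using generated g by blast
  have rp: "rev p \<in> lists S" "wp (rev p) = inv g" using p inv_word_prod by auto
  have xs: "inv g \<otimes> x \<otimes> g = s" "s \<otimes> inv g \<otimes> x \<otimes> (g \<otimes> s) = s"
  proof -
    show *: "inv g \<otimes> x \<otimes> g = s" unfolding x using g s by (simp add: m_assoc)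
    have "s \<otimes> inv g \<otimes> x \<otimes> (g \<otimes> s) = s \<otimes> (inv g \<otimes> x \<otimes> g) \<otimes> s"
      using g s xc by (simp add: m_assoc)
    then show "s \<otimes> inv g \<otimes> x \<otimes> (g \<otimes> s) = s" using * s by simp
  qed
  have cnt: "count_list (map (\<lambda>r. inv (inv g) \<otimes> r \<otimes> inv g) (refls p)) x = count_list (refls p) s"
    using count_list_conjugate[OF refls_closed[OF p(1)], of "inv g" x] g xc xs by simp
  have cnt2: "count_list (map (\<lambda>r. inv (s \<otimes> inv g) \<otimes> r \<otimes> (s \<otimes> inv g)) (refls p)) x
      = count_list (refls p) s"
    using count_list_conjugate[OF refls_closed[OF p(1)], of "s \<otimes> inv g" x] g s xc xs
    by (simp add: inv_mult_group)
  \<comment> \<open>Without the middle letter the word represents \<open>\<one>\<close>, so its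
    count is even like that of the empty word. By \<open>cnt\<close> and \<open>cnt2\<close> the
    half \<open>p\<close> contributes the same number in both words.\<close>
  have "even (count_list (refls (p @ rev p)) x)"
    using refls_parity[of "p @ rev p" "[]" x] p rp g xc by simp
  then have ev: "even (count_list (refls p) s + count_list (refls (rev p)) x)"
    using p(1) rp cnt by (simp add: refls_append)
  let ?u = "p @ s # rev p"
  have sl: "s # rev p \<in> lists S" using s rp by simp
  have "refls ?u = map (\<lambda>r. inv (s \<otimes> inv g) \<otimes> r \<otimes> (s \<otimes> inv g)) (refls p) @ x # refls (rev p)"
    using refls_append[OF p(1) sl] rp g x by simp
  then have "odd (count_list (refls ?u) x)" using ev cnt2 by simp
  moreover have "?u \<in> lists S" "wp ?u = x" using p rp sl x g s by (auto simp: m_assoc)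
  ultimately show ?thesis using that by blast
qed

lemma refls_delete:
  assumes "u \<in> lists S" "x \<in> set (refls u)"
  shows "\<exists>a s b. u = a @ s # b \<and> wp u \<otimes> x = wp (a @ b)"
  using assms
proof (induction u rule: list.induct)
  case (Cons s u)
  show ?case
  proof (cases "x \<in> set (refls u)")
    case True
    then obtain a r b where ab: "u = a @ r # b" "wp u \<otimes> x = wp (a @ b)"
      using Cons by auto
    have "u \<in> lists S" using Cons.prems(1) by simp
    then have "x \<in> carrier W" using True refls_closed by blast
    then have "wp (s # u) \<otimes> x = wp ((s # a) @ b)" using Cons.prems ab(2) by (simp add: m_assoc)
    then show ?thesis using ab(1) by (metis append_Cons)
  next
    case False
    then have x: "x = inv (wp u) \<otimes> s \<otimes> wp u" using Cons.prems by simp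
    have "wp (s # u) \<otimes> x = wp ([] @ u)"
      unfolding x using Cons.prems by (simp add: m_assoc)
    then show ?thesis by blast
  qed
qed simp

section \<open>Length and the exchange property\<close>

lemma obtain_reduced:
  assumes "w \<in> carrier W"
  obtains u where "red u w"
proof -
  have "\<exists>n. \<exists>u \<in> lists S. length u = n \<and> wp u = w" using generated assms by blast
  from LeastI_ex[OF this] show ?thesis
    using that by (auto simp: reduced_expression_def cox_length_def)
qed

lemma len_word_prod_le: "u \<in> lists S \<Longrightarrow> len (wp u) \<le> length u"
  unfolding cox_length_def by (rule Least_le) auto

lemma redD: "red u w \<Longrightarrow> u \<in> lists S" "red u w \<Longrightarrow> wp u = w" "red u w \<Longrightarrow> length u = len w"
  by (auto simp: reduced_expression_def)

lemma red_closed: "red u w \<Longrightarrow> w \<in> carrier W"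
  by (auto simp: reduced_expression_def)

lemma redI: "u \<in> lists S \<Longrightarrow> wp u = w \<Longrightarrow> length u \<le> len w \<Longrightarrow> red u w"
  using len_word_prod_le by (fastforce simp: reduced_expression_def)

lemma len_mult_le:
  assumes "w \<in> carrier W" "v \<in> carrier W"
  shows "len (w \<otimes> v) \<le> len w + len v"
proof -
  obtain u u' where "red u w" "red u' v" using obtain_reduced assms by metis
  then show ?thesis using len_word_prod_le[of "u @ u'"] by (auto simp: reduced_expression_def)
qed

lemma len_gen_le: "s \<in> S \<Longrightarrow> len s \<le> 1"
  using len_word_prod_le[of "[s]"] by simp

lemma len_mult_gen_le: "w \<in> carrier W \<Longrightarrow> s \<in> S \<Longrightarrow> len (w \<otimes> s) \<le> Suc (len w)"
  using len_mult_le[of w s] len_gen_le[of s] by simp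

lemma len_le_mult_gen: "w \<in> carrier W \<Longrightarrow> s \<in> S \<Longrightarrow> len w \<le> Suc (len (w \<otimes> s))"
  using len_mult_gen_le[of "w \<otimes> s" s] by simp

text \<open>By invariance of the parity, \<open>x\<close> also occurs in the sequence of a reduced
  word for the same element, and deleting the matching letter shortens that word.\<close>

lemma odd_refls_imp_len_less:
  assumes "u \<in> lists S" "x \<in> reflections" "odd (count_list (refls u) x)"
  shows "len (wp u \<otimes> x) < len (wp u)"
proof -
  obtain u' where u': "red u' (wp u)" using obtain_reduced assms by (metis word_prod_closed)
  then have "odd (count_list (refls u') x)"
    using refls_parity[of u u' x] assms redD[OF u'] by simp
  then have "x \<in> set (refls u')" using count_notin by fastforce
  then obtain a s b where "u' = a @ s # b" "wp u' \<otimes> x = wp (a @ b)"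
    using refls_delete redD[OF u'] by blast
  then show ?thesis using len_word_prod_le[of "a @ b"] redD[OF u'] by auto
qed

text \<open>Appending a word \<open>v\<close> for \<open>x\<close> with odd count switches the
  parity, because conjugation by \<open>x\<close> fixes \<open>x\<close>. The odd case then applies
  to \<open>u @ v\<close>, and multiplying by \<open>x\<close> leads back to
  \<open>wp u\<close>.\<close>

lemma even_refls_imp_len_less:
  assumes "u \<in> lists S" "x \<in> reflections" "even (count_list (refls u) x)"
  shows "len (wp u) < len (wp u \<otimes> x)"
proof -
  obtain v where v: "v \<in> lists S" "wp v = x" "odd (count_list (refls v) x)"
    using reflection_odd assms by blast
  have x: "x \<in> carrier W" "x \<otimes> x = \<one>" using assms reflection_square by auto
  have inv_x: "inv x = x" using x by (simp add: inv_equality)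
  have "refls (u @ v) = map (\<lambda>r. inv x \<otimes> r \<otimes> x) (refls u) @ refls v"
    using refls_append assms v by simp
  then have "odd (count_list (refls (u @ v)) x)"
    using count_list_conjugate[OF refls_closed[OF assms(1)] x(1) x(1)] v(3) assms(3) x
    by (simp add: inv_x)
  then have "len (wp (u @ v) \<otimes> x) < len (wp (u @ v))"
    using assms v by (intro odd_refls_imp_len_less) auto
  then show ?thesis using assms v x by (simp add: m_assoc)
qed

text \<open>A drop in length excludes an even count, so \<open>x\<close> occurs in the sequence of
  \<open>u\<close> itself.\<close>

lemma strong_exchange:
  assumes "u \<in> lists S" "x \<in> reflections" "len (wp u \<otimes> x) < len (wp u)"
  shows "\<exists>a s b. u = a @ s # b \<and> wp u \<otimes> x = wp (a @ b)"
proof -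
  have "odd (count_list (refls u) x)" using even_refls_imp_len_less assms by fastforce
  then have "x \<in> set (refls u)" using count_notin by fastforce
  then show ?thesis using refls_delete assms by blast
qed

lemma len_mult_reflection_neq:
  assumes "w \<in> carrier W" "x \<in> reflections"
  shows "len (w \<otimes> x) \<noteq> len w"
proof -
  obtain u where "u \<in> lists S" "wp u = w" using generated assms by blast
  then show ?thesis
    using even_refls_imp_len_less[of u x] odd_refls_imp_len_less[of u x] assms by fastforce
qed

lemma len_mult_gen_cases:
  assumes "w \<in> carrier W" "s \<in> S"
  obtains (ascent) "len (w \<otimes> s) = Suc (len w)" | (descent) "len w = Suc (len (w \<otimes> s))"
  using len_mult_reflection_neq[OF assms(1) gen_reflection[OF assms(2)]]
    len_mult_gen_le[OF assms] len_le_mult_gen[OF assms] by linarith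

section \<open>Bruhat order\<close>

inductive bruhat_le :: "'a \<Rightarrow> 'a \<Rightarrow> bool" where
  bruhat_refl: "w \<in> carrier W \<Longrightarrow> bruhat_le w w"
| bruhat_step: "bruhat_le w v \<Longrightarrow> x \<in> reflections \<Longrightarrow> len v < len (v \<otimes> x) \<Longrightarrow> bruhat_le w (v \<otimes> x)"

lemma bruhat_closed: "bruhat_le w v \<Longrightarrow> w \<in> carrier W \<and> v \<in> carrier W"
  by (induction rule: bruhat_le.induct) auto

lemma bruhat_len: "bruhat_le w v \<Longrightarrow> len w \<le> len v"
  by (induction rule: bruhat_le.induct) auto

lemma bruhat_trans: 
  assumes "bruhat_le v x" "bruhat_le w v"
  shows "bruhat_le w x"
  using assms by induction (auto intro: bruhat_step)

text \<open>One letter of the Demazure recursion, as an operation on group elements.\<close>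

definition gen_act :: "'a \<Rightarrow> 'a \<Rightarrow> 'a" where
  "gen_act w s = (if len (w \<otimes> s) > len w then w \<otimes> s else w)"

lemma bruhat_gen_act: "w \<in> carrier W \<Longrightarrow> s \<in> S \<Longrightarrow> bruhat_le w (gen_act w s)"
  by (auto simp: gen_act_def intro: bruhat_refl bruhat_step gen_reflection)

lemma bruhat_mult_gen_le_gen_act:
  assumes "w \<in> carrier W" "s \<in> S"
  shows "bruhat_le (w \<otimes> s) (gen_act w s)"
proof (cases "len (w \<otimes> s) > len w")
  case True
  then show ?thesis using assms by (auto simp: gen_act_def intro: bruhat_refl)
next
  case False
  then have "len (w \<otimes> s) < len w"
    using len_mult_reflection_neq[OF assms(1) gen_reflection[OF assms(2)]] by simp
  then have "bruhat_le (w \<otimes> s) (w \<otimes> s \<otimes> s)"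
    using assms by (intro bruhat_step bruhat_refl gen_reflection) auto
  then show ?thesis using False assms by (simp add: gen_act_def)
qed

text \<open>A form of the lifting property. If \<open>s\<close> is an ascent of \<open>w\<close> and
  \<open>x \<noteq> s\<close>, then \<open>w \<otimes> s\<close> and
  \<open>w \<otimes> x \<otimes> s\<close> differ by the reflection
  \<open>s \<otimes> x \<otimes> s\<close>, which is shown to raise the length.\<close>

lemma bruhat_gen_act_step:
  assumes w: "w \<in> carrier W" and x: "x \<in> reflections" and less: "len w < len (w \<otimes> x)" and s: "s \<in> S"
  shows "bruhat_le (gen_act w s) (gen_act (w \<otimes> x) s)"
proof (cases "len (w \<otimes> s) > len w")
  case False
  then have "gen_act w s = w" by (simp add: gen_act_def)
  moreover have "bruhat_le w (w \<otimes> x)" using assms by (intro bruhat_step bruhat_refl)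
  ultimately show ?thesis using bruhat_trans bruhat_gen_act w x s by (metis m_closed reflections_closed)
next
  case True
  then have act: "gen_act w s = w \<otimes> s" by (simp add: gen_act_def)
  show ?thesis
  proof (cases "x = s")
    case True
    then show ?thesis using act bruhat_gen_act w s by simp
  next
    case False
    let ?y = "s \<otimes> x \<otimes> s"
    have y: "?y \<in> reflections" using x s by (rule reflection_conj_gen)
    have eq: "w \<otimes> s \<otimes> ?y = w \<otimes> x \<otimes> s"
      using w x s by (simp add: m_assoc)
    have "len (w \<otimes> s) < len (w \<otimes> s \<otimes> ?y)"
    proof (rule ccontr)
      assume "\<not> ?thesis"
      then have lt: "len (w \<otimes> s \<otimes> ?y) < len (w \<otimes> s)"
        using len_mult_reflection_neq[of "w \<otimes> s" ?y] w s y by (simp add: nat_neq_iff)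
      obtain u where u: "red u w" using obtain_reduced w by blast
      have us: "u @ [s] \<in> lists S" "wp (u @ [s]) = w \<otimes> s" using redD[OF u] s by auto
      obtain a r b where ab: "u @ [s] = a @ r # b" "w \<otimes> x \<otimes> s = wp (a @ b)"
        using strong_exchange[OF us(1) y] lt us(2) eq by auto
      show False
      \<comment> \<open>Exchange deletes one letter of \<open>u @ [s]\<close>. If it is the final
        \<open>s\<close>, then \<open>x = s\<close>; if it lies in \<open>u\<close>, then
        \<open>w \<otimes> x\<close> is shorter than \<open>w\<close>.\<close>
      proof (cases b rule: rev_cases)
        case Nil
        then have "a = u" using ab by simp
        then have "w \<otimes> x \<otimes> s = w" using ab Nil redD[OF u] by simp
        then have "w \<otimes> x = w \<otimes> s" using w x s by (metis gen_cancel_right m_closed reflections_closed)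
        then have "inv w \<otimes> (w \<otimes> x) = inv w \<otimes> (w \<otimes> s)" by simp
        then show False using w x s False by simp
      next
        case (snoc b' s')
        then have *: "u = a @ r # b'" "s' = s" using ab by (auto simp flip: append_Cons append_assoc)
        have abl: "a @ b' \<in> lists S" using * redD(1)[OF u] by auto
        have "w \<otimes> x \<otimes> s = wp ((a @ b') @ [s])" using ab snoc * by simp
        then have "w \<otimes> x \<otimes> s = wp (a @ b') \<otimes> s" using abl s by (subst (asm) word_prod_append) auto
        then have "w \<otimes> x = wp (a @ b')"
          using w x s abl by (metis gen_cancel_right m_closed reflections_closed word_prod_closed)
        then have "len (w \<otimes> x) \<le> length (a @ b')" using len_word_prod_le[OF abl] by simp
        also have "\<dots> < len w" using * redD(3)[OF u] by auto
        finally show False using less by simp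
      qed
    qed
    then have "bruhat_le (w \<otimes> s) (w \<otimes> s \<otimes> ?y)"
      using w s y by (intro bruhat_step bruhat_refl) auto
    then show ?thesis
      unfolding act eq using bruhat_trans bruhat_mult_gen_le_gen_act w x s by (meson m_closed reflections_closed)
  qed
qed

lemma bruhat_gen_act_mono:
  assumes "bruhat_le w v" "s \<in> S"
  shows "bruhat_le (gen_act w s) (gen_act v s)"
  using assms
proof induction
  case (bruhat_refl w)
  then show ?case by (auto simp: gen_act_def intro: bruhat_le.bruhat_refl)
next
  case (bruhat_step w v x)
  then show ?case
    using bruhat_gen_act_step bruhat_trans bruhat_closed by meson
qed

section \<open>Reduced subwords and the Demazure product\<close>

definition contains_reduced :: "'a list \<Rightarrow> 'a \<Rightarrow> bool" where
  "contains_reduced R w \<longleftrightarrow> (\<exists>u. subseq u R \<and> red u w)"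

lemma reduced_append_gen:
  assumes "red u w" "s \<in> S" "len (w \<otimes> s) = Suc (len w)"
  shows "red (u @ [s]) (w \<otimes> s)"
  using assms by (auto simp: reduced_expression_def)

lemma reduced_butlast_gen:
  assumes "red (u @ [s]) w"
  shows "red u (w \<otimes> s)" "len w = Suc (len (w \<otimes> s))"
proof -
  have u: "u \<in> lists S" "s \<in> S" using redD(1)[OF assms] by auto
  have "w = wp u \<otimes> s" using u redD(2)[OF assms] by simp
  then have ws: "w \<otimes> s = wp u" "w \<in> carrier W" using u by auto
  have l: "Suc (length u) = len w" using redD(3)[OF assms] by simp
  then have "length u \<le> len (w \<otimes> s)" using len_le_mult_gen[of w s] u ws by simp
  then show r: "red u (w \<otimes> s)" using u ws by (intro redI) auto
  show "len w = Suc (len (w \<otimes> s))" using redD(3)[OF r] l by simp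
qed

text \<open>Exchange with \<open>s\<close> deletes a letter of a reduced subword for
  \<open>w\<close>; what remains is a reduced subword for \<open>w \<otimes> s\<close>.\<close>

lemma contains_reduced_descent:
  assumes "contains_reduced R w" "s \<in> S" "len w = Suc (len (w \<otimes> s))"
  shows "contains_reduced R (w \<otimes> s)"
proof -
  obtain u where u: "subseq u R" "red u w" using assms by (auto simp: contains_reduced_def)
  obtain a r b where ab: "u = a @ r # b" "w \<otimes> s = wp (a @ b)"
    using strong_exchange[of u s] redD[OF u(2)] assms gen_reflection by auto
  have "red (a @ b) (w \<otimes> s)"
    using redD[OF u(2)] ab assms by (intro redI) auto
  moreover have "subseq (a @ b) u" using ab by (simp add: subseq_append' list_emb_Cons)
  ultimately show ?thesis using u(1) by (auto simp: contains_reduced_def intro: subseq_order.order_trans)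
qed

lemma subseq_snoc_cases:
  assumes "subseq u (R @ [s])"
  obtains "subseq u R" | u' where "u = u' @ [s]" "subseq u' R"
proof -
  obtain a b where ab: "u = a @ b" "subseq a R" "subseq b [s]"
    using assms by (auto simp: subseq_append_iff)
  then have "b = [] \<or> b = [s]" by (auto elim: list_emb.cases)
  with ab that show ?thesis by auto
qed

text \<open>No reduced word of \<open>w\<close> ends in an ascent \<open>s\<close>, so the last
  letter cannot be used.\<close>

lemma contains_reduced_snoc_ascent:
  assumes "len (w \<otimes> s) = Suc (len w)"
  shows "contains_reduced (R @ [s]) w \<longleftrightarrow> contains_reduced R w"
proof
  assume "contains_reduced (R @ [s]) w"
  then obtain u where u: "subseq u (R @ [s])" "red u w" by (auto simp: contains_reduced_def)
  from u(1) show "contains_reduced R w"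
  proof (cases rule: subseq_snoc_cases)
    case (2 u')
    then show ?thesis using reduced_butlast_gen(2)[of u' s w] u(2) assms by simp
  qed (use u in \<open>auto simp: contains_reduced_def\<close>)
qed (auto simp: contains_reduced_def)

text \<open>A reduced subword for \<open>w \<otimes> s\<close> can be completed by the last letter.
  Conversely, a reduced subword for \<open>w\<close> either ends with that letter or lies in
  \<open>R\<close> and loses a letter by exchange.\<close>

lemma contains_reduced_snoc_descent:
  assumes "w \<in> carrier W" "s \<in> S" "len w = Suc (len (w \<otimes> s))"
  shows "contains_reduced (R @ [s]) w \<longleftrightarrow> contains_reduced R (w \<otimes> s)"
proof
  assume "contains_reduced (R @ [s]) w"
  then obtain u where u: "subseq u (R @ [s])" "red u w" by (auto simp: contains_reduced_def)
  from u(1) show "contains_reduced R (w \<otimes> s)"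
  proof (cases rule: subseq_snoc_cases)
    case 1
    then have "contains_reduced R w" using u(2) by (auto simp: contains_reduced_def)
    then show ?thesis using assms(2,3) by (rule contains_reduced_descent)
  next
    case (2 u')
    then show ?thesis using reduced_butlast_gen(1)[of u' s w] u(2) by (auto simp: contains_reduced_def)
  qed
next
  assume "contains_reduced R (w \<otimes> s)"
  then obtain u where u: "subseq u R" "red u (w \<otimes> s)" by (auto simp: contains_reduced_def)
  then have "red (u @ [s]) w" using reduced_append_gen[of u "w \<otimes> s" s] assms by simp
  moreover have "subseq (u @ [s]) (R @ [s])" using u(1) by simp
  ultimately show "contains_reduced (R @ [s]) w" unfolding contains_reduced_def by blast
qed

lemma demazure_snoc': "demazure W S (Q @ [s]) = gen_act (demazure W S Q) s"
  by (simp add: demazure_snoc gen_act_def)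

lemma demazure_closed [simp]: "Q \<in> lists S \<Longrightarrow> demazure W S Q \<in> carrier W"
  by (induction Q rule: rev_induct) (auto simp: demazure_Nil demazure_snoc)

lemma contains_reduced_closed: "contains_reduced R w \<Longrightarrow> w \<in> carrier W"
  using red_closed by (auto simp: contains_reduced_def)

text \<open>The last letter is treated as in the Demazure recursion. In the descent case
  \<open>w\<close> is \<open>gen_act (w \<otimes> s) s\<close>, and \<open>gen_act\<close> is
  monotone.\<close>

lemma contains_reduced_bruhat:
  assumes "Q \<in> lists S" "contains_reduced Q w"
  shows "bruhat_le w (demazure W S Q)"
  using assms
proof (induction Q arbitrary: w rule: rev_induct)
  case Nil
  then have "red [] w" by (auto simp: contains_reduced_def dest: list_emb_Nil2)
  then have "w = \<one>" using redD(2) by fastforce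
  then show ?case by (simp add: demazure_Nil bruhat_refl)
next
  case (snoc s Q)
  have w: "w \<in> carrier W" using snoc.prems contains_reduced_closed by blast
  have sQ: "s \<in> S" "Q \<in> lists S" using snoc.prems by auto
  show ?case
    using w sQ(1)
  proof (cases rule: len_mult_gen_cases)
    case ascent
    then have "bruhat_le w (demazure W S Q)"
      using snoc sQ contains_reduced_snoc_ascent by blast
    then show ?thesis
      unfolding demazure_snoc' using sQ bruhat_trans bruhat_gen_act demazure_closed by blast
  next
    case descent
    then have "bruhat_le (w \<otimes> s) (demazure W S Q)"
      using snoc sQ w contains_reduced_snoc_descent by blast
    then have "bruhat_le (gen_act (w \<otimes> s) s) (gen_act (demazure W S Q) s)"
      using sQ by (intro bruhat_gen_act_mono)
    moreover have "gen_act (w \<otimes> s) s = w" using descent w sQ by (simp add: gen_act_def)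
    ultimately show ?thesis by (simp add: demazure_snoc')
  qed
qed


section \<open>Subword complexes\<close>

lemma reduced_prefix:
  assumes "red (u @ v) w"
  shows "red u (wp u)"
proof (rule redI)
  have uv: "u \<in> lists S" "v \<in> lists S" using redD(1)[OF assms] by auto
  show "u \<in> lists S" by fact
  have "length u + length v = len (wp u \<otimes> wp v)"
    using redD(2,3)[OF assms] uv by simp
  also have "\<dots> \<le> len (wp u) + len (wp v)" using uv by (intro len_mult_le) auto
  also have "\<dots> \<le> len (wp u) + length v" using len_word_prod_le[OF uv(2)] by simp
  finally show "length u \<le> len (wp u)" by simp
qed simp

text \<open>An element with every generator as descent has each reduced word as a right factor, with
  lengths adding up. The word is grown letter by letter at its right end; the longest element will
  be put in for it.\<close>

lemma full_descent_factor:
  assumes v: "v \<in> carrier W" and desc: "\<And>s. s \<in> S \<Longrightarrow> len (v \<otimes> s) < len v"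
    and "red u (wp u)"
  shows "\<exists>x \<in> carrier W. v = x \<otimes> wp u \<and> len v = len x + length u"
  using assms(3)
proof (induction u rule: rev_induct)
  case Nil
  then show ?case using v by simp
next
  case (snoc t u)
  have ut: "u \<in> lists S" "t \<in> S" using redD(1)[OF snoc.prems] by auto
  obtain x where x: "x \<in> carrier W" "v = x \<otimes> wp u" "len v = len x + length u"
    using snoc.IH reduced_prefix[OF snoc.prems] by blast
  obtain a where a: "red a x" using obtain_reduced x(1) by blast
  have al: "a \<in> lists S" "wp a = x" "length a = len x" using redD[OF a] by auto
  have au: "a @ u \<in> lists S" "wp (a @ u) = v" using al x ut by auto
  obtain c r d where cd: "a @ u = c @ r # d" "v \<otimes> t = wp (c @ d)"
    using strong_exchange[OF au(1) gen_reflection[OF ut(2)]] desc[OF ut(2)] au(2) by auto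
  \<comment> \<open>If the deleted letter lies in \<open>a\<close>, the new letter \<open>t\<close>
    takes its place at the end. If it lies in \<open>u\<close>, then \<open>u @ [t]\<close> would
    not be reduced.\<close>
  consider d' where "a = c @ r # d'" "d = d' @ u" | c' where "c = a @ c'" "u = c' @ r # d"
    using cd(1) by (auto simp: append_eq_append_conv2 append_eq_Cons_conv)
  then show ?case
  proof cases
    case (1 d')
    note a_eq = 1(1)
    have cd': "c @ d' \<in> lists S" using al(1) a_eq by auto
    have "v \<otimes> t = wp ((c @ d') @ u)" using cd 1(2) by simp
    also have "\<dots> = wp (c @ d') \<otimes> wp u" using cd' ut by (intro word_prod_append)
    finally have "v = wp (c @ d') \<otimes> wp u \<otimes> t"
      using v ut by (metis gen_cancel_right)
    then have v_eq: "v = wp (c @ d') \<otimes> wp (u @ [t])"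
      using cd' ut by (simp add: m_assoc del: append_assoc)
    have "len v \<le> len (wp (c @ d')) + len (wp (u @ [t]))"
      unfolding v_eq using cd' ut by (intro len_mult_le word_prod_closed) auto
    moreover have "len (wp (u @ [t])) \<le> length (u @ [t])"
      using ut by (intro len_word_prod_le) auto
    moreover have "len (wp (c @ d')) \<le> length (c @ d')" by (rule len_word_prod_le[OF cd'])
    moreover have "length (c @ d') + 1 = len x" using al(3) a_eq by simp
    \<comment> \<open>The upper bounds for the two factors add up to \<open>len v\<close>, so they
      are attained.\<close>
    ultimately have "len v = len (wp (c @ d')) + length (u @ [t])" using x(3) by simp
    then show ?thesis using v_eq word_prod_closed[OF cd'] by blast
  next
    case (2 c')
    note c = 2
    have cd': "c' @ d \<in> lists S" using ut c by auto
    have "x \<otimes> (wp u \<otimes> t) = x \<otimes> wp (c' @ d)"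
      using cd(2) c(1) x(1,2) al cd' ut by (simp add: m_assoc)
    then have "inv x \<otimes> (x \<otimes> (wp u \<otimes> t)) = inv x \<otimes> (x \<otimes> wp (c' @ d))" by simp
    then have "wp u \<otimes> t = wp (c' @ d)"
      using x(1) ut word_prod_closed[OF cd'] by (simp del: word_prod_append)
    then have "wp (u @ [t]) = wp (c' @ d)" using ut by simp
    then have "length (u @ [t]) \<le> length (c' @ d)"
      using len_word_prod_le[OF cd'] redD(3)[OF snoc.prems] by simp
    then show ?thesis using c(2) by simp
  qed
qed

text \<open>Additivity of lengths makes each letter of \<open>c\<close> an ascent when it is
  reached.\<close>

lemma demazure_append_reduced:
  assumes "Q \<in> lists S" "c \<in> lists S"
    "len (demazure W S Q \<otimes> wp c) = len (demazure W S Q) + length c"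
  shows "demazure W S (Q @ c) = demazure W S Q \<otimes> wp c"
  using assms(2,3)
proof (induction c rule: rev_induct)
  case Nil
  then show ?case using assms(1) by simp
next
  case (snoc s c)
  let ?d = "demazure W S Q"
  have cs: "c \<in> lists S" "s \<in> S" and d: "?d \<in> carrier W" using snoc.prems assms(1) by auto
  have eq: "?d \<otimes> wp (c @ [s]) = ?d \<otimes> wp c \<otimes> s" using cs d by (simp add: m_assoc)
  have le: "len (?d \<otimes> wp c) \<le> len ?d + length c"
    using len_mult_le[OF d word_prod_closed[OF cs(1)]] len_word_prod_le[OF cs(1)] by linarith
  moreover have "len (?d \<otimes> wp c \<otimes> s) \<le> Suc (len (?d \<otimes> wp c))"
    using cs d by (intro len_mult_gen_le) auto
  ultimately have l: "len (?d \<otimes> wp c) = len ?d + length c"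
    using snoc.prems(2) unfolding eq by simp
  then have IH: "demazure W S (Q @ c) = ?d \<otimes> wp c" using snoc.IH cs by blast
  have "demazure W S ((Q @ c) @ [s]) = ?d \<otimes> wp c \<otimes> s"
    unfolding demazure_snoc IH using snoc.prems(2) l eq by simp
  then show ?case using eq by simp
qed

lemma subword_complex_eq:
  "subword_complex W S Q w = {P. P \<subseteq> {..<length Q} \<and> contains_reduced (nths Q (- P)) w}"
  by (simp add: subword_complex_def contains_reduced_def)

lemma contains_reduced_mono: "subseq R R' \<Longrightarrow> contains_reduced R w \<Longrightarrow> contains_reduced R' w"
  unfolding contains_reduced_def using subseq_order.order_trans by blast

lemma subword_complex_contains:
  "P \<in> subword_complex W S Q w \<Longrightarrow> contains_reduced Q w"
  unfolding subword_complex_eq using contains_reduced_mono subseq_nths by blast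

lemma empty_in_subword_complex:
  "{} \<in> subword_complex W S Q w \<longleftrightarrow> contains_reduced Q w"
  by (simp add: subword_complex_eq nths_all)

lemma simplicial_complex_subword_complex: "simplicial_complex (subword_complex W S Q w)"
  unfolding simplicial_complex_def
proof (intro ballI conjI allI impI)
  fix P R assume P: "P \<in> subword_complex W S Q w" and R: "R \<subseteq> P"
  have "subseq (nths Q (- P)) (nths Q (- R))" using R by (intro subseq_nths_mono) auto
  then show "R \<in> subword_complex W S Q w"
    using P R contains_reduced_mono by (auto simp: subword_complex_eq)
qed (auto simp: subword_complex_eq intro: finite_subset)

lemma finite_subword_complex: "finite (subword_complex W S Q w)"
  by (rule finite_subset[of _ "Pow {..<length Q}"]) (auto simp: subword_complex_eq)

text \<open>The faces are split by the new position \<open>length Q\<close>: first its deletion,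
  then the faces through it, whose link is the complex of \<open>Q\<close> for the same
  \<open>w\<close>.\<close>

lemma subword_complex_snoc:
  "subword_complex W S (Q @ [s]) w =
     {P. P \<subseteq> {..<length Q} \<and> contains_reduced (nths Q (- P) @ [s]) w} \<union>
     insert (length Q) ` subword_complex W S Q w" (is "?L = ?A \<union> ?B")
proof -
  let ?n = "length Q"
  have app: "nths (Q @ [s]) (- P) = nths Q (- P) @ (if ?n \<in> P then [] else [s])" for P
    by (simp add: nths_append)
  have ins: "nths Q (- insert ?n P) = nths Q (- P)" for P
    by (rule nths_cong) auto
  have "?A \<subseteq> ?L" by (auto simp: subword_complex_eq app)
  moreover have "?B \<subseteq> ?L" by (auto simp: subword_complex_eq app ins)
  moreover have "P \<in> ?A \<union> ?B" if "P \<in> ?L" for P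
  proof (cases "?n \<in> P")
    case False
    then show ?thesis using that by (auto simp: subword_complex_eq app less_Suc_eq)
  next
    case True
    then have P: "P = insert ?n (P - {?n})" by auto
    have "nths Q (- P) = nths Q (- (P - {?n}))" by (subst P, rule ins)
    then have "P - {?n} \<in> subword_complex W S Q w"
      using that True by (auto simp: subword_complex_eq app less_Suc_eq)
    then have "insert ?n (P - {?n}) \<in> ?B" by (rule imageI)
    then have "P \<in> ?B" by (simp only: P[symmetric])
    then show ?thesis by (rule UnI2)
  qed
  ultimately show ?thesis by (intro equalityI subsetI Un_least) auto
qed

lemma collapsible_subword_complex:
  assumes "Q \<in> lists S" "contains_reduced Q w" "demazure W S Q \<noteq> w"
  shows "collapsible (subword_complex W S Q w)"
  using assms
proof (induction Q arbitrary: w rule: rev_induct)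
  case Nil
  then have "red [] w" by (auto simp: contains_reduced_def dest: list_emb_Nil2)
  then have "w = \<one>" using redD(2) by fastforce
  then show ?case using Nil by (simp add: demazure_Nil)
next
  case (snoc s Q)
  have sQ: "s \<in> S" "Q \<in> lists S" using snoc.prems(1) by auto
  have w: "w \<in> carrier W" using snoc.prems(2) by (rule contains_reduced_closed)
  let ?D = "subword_complex W S Q"
  have new: "length Q \<notin> \<Union>(?D v)" for v by (auto simp: subword_complex_eq)
  show ?case
    using w sQ(1)
  proof (cases rule: len_mult_gen_cases)
    case ascent
    then have "subword_complex W S (Q @ [s]) w = ?D w \<union> insert (length Q) ` ?D w"
      unfolding subword_complex_snoc contains_reduced_snoc_ascent[OF ascent]
      by (simp add: subword_complex_eq)
    moreover have "{} \<in> ?D w"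
      using snoc.prems(2) contains_reduced_snoc_ascent[OF ascent] empty_in_subword_complex by blast
    ultimately show ?thesis
      using collapsible_cone[OF finite_subword_complex simplicial_complex_subword_complex _ new]
      by metis
  next
    case descent
    note desc = contains_reduced_snoc_descent[OF w sQ(1) descent]
    have eq: "subword_complex W S (Q @ [s]) w = ?D (w \<otimes> s) \<union> insert (length Q) ` ?D w"
      unfolding subword_complex_snoc desc by (simp add: subword_complex_eq)
    \<comment> \<open>Otherwise the letter \<open>s\<close> would raise the Demazure product from
      \<open>w \<otimes> s\<close> to \<open>w\<close>.\<close>
    have "demazure W S Q \<noteq> w \<otimes> s"
      using snoc.prems(3) descent w sQ by (auto simp: demazure_snoc)
    then have del: "collapsible (?D (w \<otimes> s))"
      using snoc.IH sQ(2) snoc.prems(2) desc by blast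
    \<comment> \<open>Otherwise \<open>s\<close>, a descent of \<open>w\<close>, would leave the
      Demazure product at \<open>w\<close>.\<close>
    have "demazure W S Q \<noteq> w"
      using snoc.prems(3) descent w sQ by (auto simp: demazure_snoc)
    then have link: "collapsible (?D w)" if "contains_reduced Q w"
      using snoc.IH sQ(2) that by blast
    show ?thesis
    proof (cases "contains_reduced Q w")
      case True
      have "?D w \<subseteq> ?D (w \<otimes> s)"
        using contains_reduced_descent[OF _ sQ(1) descent] by (auto simp: subword_complex_eq)
      then show ?thesis
        unfolding eq using link[OF True] del new by (intro collapsible_attach_cone)
    next
      case False
      \<comment> \<open>The link is void: the new position is not a vertex and the complex equals
        its deletion.\<close>
      then have "?D w = {}" using subword_complex_contains by blast
      then show ?thesis using del eq by simp
    qed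
  qed
qed

lemma sphere_imp_demazure:
  assumes "Q \<in> lists S" "simplicial_sphere (subword_complex W S Q w)"
  shows "demazure W S Q = w"
proof (rule ccontr)
  assume neq: "demazure W S Q \<noteq> w"
  show False
  proof (cases "contains_reduced Q w")
    case True
    then show False using collapsible_subword_complex collapsible_not_sphere assms neq by blast
  next
    case False
    then have "subword_complex W S Q w = {}" using subword_complex_contains by blast
    then obtain d where "geometric_realization ({} :: nat set set) homeomorphic_space nsphere d"
      using assms(2) by (auto simp: simplicial_sphere_def)
    \<comment> \<open>The void complex has an empty realization, whereas every
      \<open>nsphere d\<close> is nonempty.\<close>
    moreover have "geometric_realization ({} :: nat set set) = trivial_topology"
      by (simp add: geometric_realization_def)
    ultimately show False using homeomorphic_empty_space nonempty_nsphere by metis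
  qed
qed

lemma subword_complex_append:
  assumes Q: "Q \<in> lists S" and c: "c \<in> lists S" and w: "demazure W S Q = w"
    and len: "len (w \<otimes> wp c) = len w + length c"
  shows "subword_complex W S (Q @ c) (w \<otimes> wp c) = subword_complex W S Q w"
proof (intro equalityI subsetI)
  let ?n = "length Q"
  have wc: "w \<in> carrier W" using Q w by auto
  fix P
  { assume P: "P \<in> subword_complex W S Q w"
    then obtain u where u: "P \<subseteq> {..<?n}" "subseq u (nths Q (- P))" "red u w"
      by (auto simp: subword_complex_eq contains_reduced_def)
    have "nths c {j. j + ?n \<in> - P} = c" using u(1) by (intro nths_all) auto
    then have "subseq (u @ c) (nths (Q @ c) (- P))" using u(2) by (simp add: nths_append)
    moreover have "red (u @ c) (w \<otimes> wp c)"
      using u(3) c len by (auto simp: reduced_expression_def)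
    moreover have "P \<subseteq> {..<length (Q @ c)}" using u(1) by auto
    ultimately show "P \<in> subword_complex W S (Q @ c) (w \<otimes> wp c)"
      by (auto simp: subword_complex_eq contains_reduced_def) }
  assume "P \<in> subword_complex W S (Q @ c) (w \<otimes> wp c)"
  then obtain u where P: "P \<subseteq> {..<?n + length c}" and u: "subseq u (nths (Q @ c) (- P))"
      "red u (w \<otimes> wp c)"
    by (auto simp: subword_complex_eq contains_reduced_def)
  let ?B = "{j. j + ?n \<in> - P}"
  obtain u1 u2 where u12: "u = u1 @ u2" "subseq u1 (nths Q (- P))" "subseq u2 (nths c ?B)"
    using u(1) by (auto simp: nths_append subseq_append_iff)
  have r1: "red u1 (wp u1)" using reduced_prefix u(2) u12(1) by blast
  then have "contains_reduced Q (wp u1)"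
    using u12(2) subseq_nths subseq_order.order_trans unfolding contains_reduced_def by blast
  \<comment> \<open>The part of \<open>u\<close> inside \<open>Q\<close> represents an element below
    the Demazure product \<open>w\<close> in Bruhat order.\<close>
  then have "length u1 \<le> len w"
    using bruhat_len[OF contains_reduced_bruhat[OF Q]] redD(3)[OF r1] w by simp
  moreover have "length u1 + length u2 = len w + length c"
    using redD(3)[OF u(2)] u12(1) len by simp
  moreover have sub: "subseq u2 c" using u12(3) subseq_nths subseq_order.order_trans by blast
  moreover have "length u2 \<le> length (nths c ?B)" using u12(3) by (rule list_emb_length)
  moreover have "length (nths c ?B) \<le> length c" using subseq_nths by (rule list_emb_length)
  \<comment> \<open>The total length leaves no slack: \<open>u2\<close> uses all of
    \<open>c\<close>, so no position of \<open>c\<close> belongs to \<open>P\<close>.\<close>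
  ultimately have l: "length u2 = length c" "length (nths c ?B) = length c" by auto
  have "u2 = c" using sub l(1) by (rule subseq_same_length)
  have "{i. i < length c \<and> i \<in> ?B} = {..<length c}"
    using l(2) by (intro card_subset_eq) (auto simp: length_nths)
  then have notP: "i + ?n \<notin> P" if "i < length c" for i using that by auto
  have Pn: "P \<subseteq> {..<?n}"
  proof
    fix i assume i: "i \<in> P"
    then have "i < ?n + length c" using P by auto
    show "i \<in> {..<?n}"
    proof (rule ccontr)
      assume "i \<notin> {..<?n}"
      then have "i - ?n < length c" "i - ?n + ?n = i" using \<open>i < ?n + length c\<close> by auto
      then show False using notP i by metis
    qed
  qed
  have "wp u1 \<otimes> wp c = w \<otimes> wp c"
    using redD[OF u(2)] u12(1) \<open>u2 = c\<close> by auto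
  then have "wp u1 \<otimes> wp c \<otimes> inv (wp c) = w \<otimes> wp c \<otimes> inv (wp c)" by simp
  then have "wp u1 = w" using wc c redD(1)[OF r1] by (simp add: m_assoc)
  then have "contains_reduced (nths Q (- P)) w" using r1 u12(2) by (auto simp: contains_reduced_def)
  then show "P \<in> subword_complex W S Q w" using Pn by (simp add: subword_complex_eq)
qed

end

section \<open>The longest element\<close>

context finite_coxeter_system
begin

lemma longest_element:
  shows longest_element_closed: "longest_element W S \<in> carrier W"
    and longest_element_max: "w \<in> carrier W \<Longrightarrow> len w \<le> len (longest_element W S)"
proof -
  \<comment> \<open>\<open>ARG_MAX\<close> is attained only if the lengths are bounded; finiteness
    of the group gives the bound.\<close>
  have "\<forall>w. w \<in> carrier W \<longrightarrow> len w < Suc (Max (len ` carrier W))"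
    using finite_carrier by (simp add: less_Suc_eq_le)
  from arg_max_nat_lemma[OF one_closed this]
  show "longest_element W S \<in> carrier W"
    and "w \<in> carrier W \<Longrightarrow> len w \<le> len (longest_element W S)"
    by (simp_all add: longest_element_def)
qed

text \<open>Splitting off a reduced word of the longest element leaves a cofactor \<open>x\<close>,
  whose length is 0 by maximality.\<close>

lemma full_descent_eq_longest:
  assumes "v \<in> carrier W" "\<And>s. s \<in> S \<Longrightarrow> len (v \<otimes> s) < len v"
  shows "v = longest_element W S"
proof -
  obtain u where u: "red u (longest_element W S)"
    using obtain_reduced longest_element_closed by blast
  then have "red u (wp u)" using redD(2)[OF u] by simp
  from full_descent_factor[OF assms this] obtain x where
    x: "x \<in> carrier W" "v = x \<otimes> longest_element W S" "len v = len x + len (longest_element W S)"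
    using redD[OF u] by auto
  then have "len x = 0" using longest_element_max[OF assms(1)] by simp
  moreover obtain a where "red a x" using obtain_reduced x(1) by blast
  ultimately have "x = \<one>" by (auto simp: reduced_expression_def)
  then show ?thesis using x longest_element_closed by simp
qed

text \<open>Any element other than the longest one has an ascent, so greedy ascents reach the top,
  each closing the length gap by one.\<close>

lemma extend_to_longest:
  assumes "w \<in> carrier W"
  shows "\<exists>c \<in> lists S. w \<otimes> wp c = longest_element W S \<and>
    len (longest_element W S) = len w + length c"
  using assms
proof (induction "len (longest_element W S) - len w" arbitrary: w rule: less_induct)
  case less
  show ?case
  proof (cases "\<forall>s\<in>S. len (w \<otimes> s) < len w")
    case True
    then have "w = longest_element W S" using full_descent_eq_longest less.prems by blast
    then show ?thesis using less.prems by (intro bexI[of _ "[]"]) auto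
  next
    case False
    then obtain s where s: "s \<in> S" "\<not> len (w \<otimes> s) < len w" by blast
    have asc: "len (w \<otimes> s) = Suc (len w)"
      using less.prems s(1) by (cases rule: len_mult_gen_cases) (use s(2) in auto)
    have ws: "w \<otimes> s \<in> carrier W" using less.prems s by simp
    have "len (w \<otimes> s) \<le> len (longest_element W S)" using longest_element_max[OF ws] .
    then obtain c where c: "c \<in> lists S" "w \<otimes> s \<otimes> wp c = longest_element W S"
        "len (longest_element W S) = len (w \<otimes> s) + length c"
      using less.hyps[OF _ ws] asc by (metis diff_less_mono2 lessI less_le_trans less_eq_Suc_le)
    then show ?thesis using asc s less.prems by (intro bexI[of _ "s # c"]) (auto simp: m_assoc)
  qed
qed

end

lemma complex_iso_refl: "complex_iso K K"
  unfolding complex_iso_def by (rule exI[of _ id]) auto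

theorem theorem3p7:
  fixes W :: "('a, 'b) monoid_scheme" and S :: "'a set" and Q :: "'a list" and \<pi> :: 'a
  assumes "finite_coxeter_system W S"
    and "Q \<in> lists S"
    and "\<pi> \<in> carrier W"
    and "simplicial_sphere (subword_complex W S Q \<pi>) \<or> demazure W S Q = \<pi>"
  shows "\<exists>Q' \<in> lists S. demazure W S Q' = longest_element W S \<and>
           complex_iso (subword_complex W S Q \<pi>) (subword_complex W S Q' (longest_element W S))"
proof -
  interpret finite_coxeter_system W S by fact
  have \<pi>: "demazure W S Q = \<pi>" using assms sphere_imp_demazure by blast
  obtain c where c: "c \<in> lists S" "\<pi> \<otimes>\<^bsub>W\<^esub> wp c = longest_element W S"
      "len (longest_element W S) = len \<pi> + length c"
    using extend_to_longest assms(3) by blast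
  \<comment> \<open>The two complexes are equal as sets of faces, so the identity is the required
    isomorphism.\<close>
  have "subword_complex W S (Q @ c) (longest_element W S) = subword_complex W S Q \<pi>"
    using subword_complex_append[OF assms(2) c(1) \<pi>] c by simp
  moreover have "demazure W S (Q @ c) = longest_element W S"
    using demazure_append_reduced[OF assms(2) c(1)] \<pi> c by simp
  ultimately show ?thesis
    using assms(2) c(1) complex_iso_refl by (intro bexI[of _ "Q @ c"]) auto
qed

end
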